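(* Let $n\ge 4$ be an integer with $n\equiv 0$ or $1 \pmod 4$. Let $lsc(n)=|\mathcal{S}_n|$ be the number of labelled self-complementary graphs of order $n$, and let $\mathcal{L}(\mathcal{S}_n)$ be the set of all exponents $L$ such that $x^L$ occurs with nonzero coefficient in the expansion of the polynomial $U^{(n)}(x)$. Then $$lsc(n)=|\mathcal{L}(\mathcal{S}_n)|.$$
   Context: Let $V=\{1,\dots,n\}$ and let $\binom{V}{2}$ be the set of 2-element subsets of $V$; write $ij$ for $\{i,j\}$ with $i<j$. A labelled graph of order $n$ is a pair $G=(V,E)$ with $E\subseteq\binom{V}{2}$; $\overline{G}=(V,\binom{V}{2}\setminus E)$ is its complement. Let $A$ be the symmetric group on $V$. For $\alpha\in A$, $\alpha G$ is the graph on $V$ with edge-set $\{\{\alpha i,\alpha j\}: ij\in E\}$, and $\alpha'$ is the permutation of $\binom{V}{2}$ given by $\alpha'\{i,j\}=\{\alpha i,\alpha j\}$. $Z(\alpha')$ denotes the set of all cycles (including cycles of length 1) in the disjoint cycle decomposition of $\alpha'$. $G$ is self-complementary if $\alpha G=\overline{G}$ for some $\alpha\in A$; $\mathcal{S}_n$ is the set of all self-complementary labelled graphs on $V$. Put $A_S=\{\alpha\in A:\exists G\in\mathcal{S}_n,\ \alpha G=\overline{G}\}$. Let $\lambda=\binom{n}{2}$, and for $ij\in\binom{V}{2}$ ($i<j$) let $p_{ij}=\frac{(2n-i)(i-1)}{2}+(j-i)$ and $w(ij)=2^{\lambda-p_{ij}}$; $w$ is a bijection from $\binom{V}{2}$ onto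 $\{2^0,2^1,\dots,2^{\lambda-1}\}$. For $\alpha\in A_S$, every cycle $z\in Z(\alpha')$ has even length. Write $z=(i_1j_1,i_2j_2,\dots,i_kj_k)$, starting with the element of $z$ at which $w$ is largest, and let $P_1(z)=\{i_1j_1,i_3j_3,\dots,i_{k-1}j_{k-1}\}$ and $P_2(z)=\{i_2j_2,i_4j_4,\dots,i_kj_k\}$. Put $W_1(z)=\sum_{ij\in P_1(z)}w(ij)$, $W_2(z)=\sum_{ij\in P_2(z)}w(ij)$, and define the polynomials $$U_\alpha^{(n)}(x)=\prod_{z\in Z(\alpha')}\bigl(x^{W_1(z)}+x^{W_2(z)}\bigr),\qquad U^{(n)}(x)=\sum_{\alpha\in A_S}U_\alpha^{(n)}(x).$$ *)

theory Defs
  imports "HOL-Combinatorics.Cycles" "HOL-Computational_Algebra.Polynomial"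
begin

type_synonym graph = "nat set \<times> nat set set"

definition vertices :: "nat \<Rightarrow> nat set" where
  "vertices n = {1..n}"

definition all_edges :: "nat set \<Rightarrow> nat set set" where
  "all_edges V = {e. e \<subseteq> V \<and> card e = 2}"

definition labelled_graphs :: "nat \<Rightarrow> graph set" where
  "labelled_graphs n = {(V, E). V = vertices n \<and> E \<subseteq> all_edges V}"

definition graph_complement :: "graph \<Rightarrow> graph" where
  "graph_complement G = (fst G, all_edges (fst G) - snd G)"

definition relabel :: "(nat \<Rightarrow> nat) \<Rightarrow> graph \<Rightarrow> graph" where
  "relabel \<alpha> G = (fst G, (\<lambda>e. \<alpha> ` e) ` snd G)"

definition self_complementary :: "graph \<Rightarrow> bool" where
  "self_complementary G \<longleftrightarrow> (\<exists>\<alpha>. \<alpha> permutes fst G \<and> relabel \<alpha> G = graph_complement G)"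

definition sc_graphs :: "nat \<Rightarrow> graph set" where
  "sc_graphs n = {G \<in> labelled_graphs n. self_complementary G}"

definition lsc :: "nat \<Rightarrow> nat" where
  "lsc n = card (sc_graphs n)"

definition sc_perms :: "nat \<Rightarrow> (nat \<Rightarrow> nat) set" where
  "sc_perms n =
     {\<alpha>. \<alpha> permutes vertices n \<and> (\<exists>G\<in>sc_graphs n. relabel \<alpha> G = graph_complement G)}"

text \<open>The permutation of the 2-subsets induced by \<open>\<alpha>\<close>, extended by the identity to all
  other sets, so that it \<open>permutes\<close> the set of 2-subsets in the sense of the library.\<close>

definition edge_perm :: "nat \<Rightarrow> (nat \<Rightarrow> nat) \<Rightarrow> nat set \<Rightarrow> nat set" where
  "edge_perm n \<alpha> e = (if e \<in> all_edges (vertices n) then \<alpha> ` e else e)"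

text \<open>For \<open>e = {i, j}\<close> with \<open>i < j\<close>, \<open>i = Min e\<close> and \<open>j = Max e\<close>.  On 2-subsets of
  \<open>{1..n}\<close> no natural-number subtraction truncates, and the division by 2 is exact,
  because \<open>2n - i\<close> and \<open>i - 1\<close> have different parities.\<close>

definition edge_pos :: "nat \<Rightarrow> nat set \<Rightarrow> nat" where
  "edge_pos n e = (let i = Min e; j = Max e in (2 * n - i) * (i - 1) div 2 + (j - i))"

definition weight :: "nat \<Rightarrow> nat set \<Rightarrow> nat" where
  "weight n e = 2 ^ ((n choose 2) - edge_pos n e)"

text \<open>A cycle of the induced permutation is represented by the list of its elements in
  cyclic order, written from its element of largest weight.  Since weights are distinct, each
  cycle (fixed points included) has exactly one such list; \<open>support p e\<close> is
  \<open>[e, p e, p (p e), \<dots>]\<close> up to just before the first return to \<open>e\<close>.\<close>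

definition edge_cycles :: "nat \<Rightarrow> (nat \<Rightarrow> nat) \<Rightarrow> nat set list set" where
  "edge_cycles n \<alpha> =
     {z. \<exists>e\<in>all_edges (vertices n). z = support (edge_perm n \<alpha>) e \<and>
           (\<forall>f\<in>set z. weight n f \<le> weight n e)}"

text \<open>List positions start at 0, so the odd-numbered entries of a cycle are those
  at even list positions.\<close>

definition P1 :: "'a list \<Rightarrow> 'a set" where
  "P1 z = {z ! k | k. k < length z \<and> even k}"

definition P2 :: "'a list \<Rightarrow> 'a set" where
  "P2 z = {z ! k | k. k < length z \<and> odd k}"

definition W1 :: "nat \<Rightarrow> nat set list \<Rightarrow> nat" where
  "W1 n z = (\<Sum>e\<in>P1 z. weight n e)"

definition W2 :: "nat \<Rightarrow> nat set list \<Rightarrow> nat" where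
  "W2 n z = (\<Sum>e\<in>P2 z. weight n e)"

definition U_perm :: "nat \<Rightarrow> (nat \<Rightarrow> nat) \<Rightarrow> int poly" where
  "U_perm n \<alpha> = (\<Prod>z\<in>edge_cycles n \<alpha>. monom 1 (W1 n z) + monom 1 (W2 n z))"

definition U :: "nat \<Rightarrow> int poly" where
  "U n = (\<Sum>\<alpha>\<in>sc_perms n. U_perm n \<alpha>)"

definition exponents :: "'a::zero poly \<Rightarrow> nat set" where
  "exponents p = {L. coeff p L \<noteq> 0}"

end

theory Submission
  imports Defs "HOL-Library.Nat_Bijection"
begin

text \<open>The weights are distinct powers of two, so the total weight of an edge set determines the
  edge set. A permutation \<open>\<alpha>\<close> takes \<open>G\<close> to its complement iff the edges and non-edges of \<open>G\<close>
  alternate along every cycle of \<open>\<alpha>'\<close>, i.e. iff \<open>G\<close> contains exactly one of \<open>P\<^sub>1(z)\<close>, \<open>P\<^sub>2(z)\<close> from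
  each cycle \<open>z\<close>. Hence the monomials in the expansion of \<open>U\<^sub>\<alpha>\<close> are the \<open>x\<close> to the total weight of
  such \<open>G\<close>; all coefficients are nonnegative, so no exponent cancels in the sum over \<open>\<alpha>\<close>.\<close>

section \<open>Alternating sets of a permutation\<close>

text \<open>The condition that a permutation \<open>p\<close> of \<open>X\<close> maps
  \<open>E\<close> onto its complement in \<open>X\<close>, put pointwise so that it can be checked
  along each cycle.\<close>

definition alternating :: "('a \<Rightarrow> 'a) \<Rightarrow> 'a set \<Rightarrow> 'a set \<Rightarrow> bool" where
  "alternating p X E \<longleftrightarrow> E \<subseteq> X \<and> (\<forall>x\<in>X. p x \<in> E \<longleftrightarrow> x \<notin> E)"

definition leader_cycles :: "('a \<Rightarrow> nat) \<Rightarrow> ('a \<Rightarrow> 'a) \<Rightarrow> 'a set \<Rightarrow> 'a list set" where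
  "leader_cycles w p X = {z. \<exists>x\<in>X. z = support p x \<and> (\<forall>y\<in>set z. w y \<le> w x)}"

text \<open>A choice of one class per cycle is coded by the set \<open>S\<close> of cycles
  contributing \<open>P1\<close>, because such sets index the terms of a multiplied-out product of
  binomials.\<close>

definition choose_classes :: "'a list set \<Rightarrow> 'a list set \<Rightarrow> 'a set" where
  "choose_classes Z S = (\<Union>z\<in>Z. if z \<in> S then P1 z else P2 z)"

lemma image_eq_Diff_iff_alternating:
  assumes "p permutes X" and "E \<subseteq> X"
  shows "p ` E = X - E \<longleftrightarrow> alternating p X E"
proof
  have inj: "inj p" and "p ` X = X"
    using assms by (simp_all add: permutes_inj permutes_image)
  assume eq: "p ` E = X - E"
  have "p x \<in> E \<longleftrightarrow> x \<notin> E" if "x \<in> X" for x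
    using that eq \<open>p ` X = X\<close> inj_image_mem_iff[OF inj, of x E] by blast
  then show "alternating p X E"
    using assms(2) by (simp add: alternating_def)
next
  have "p ` X = X"
    using assms(1) by (rule permutes_image)
  assume "alternating p X E"
  then show "p ` E = X - E"
    using \<open>p ` X = X\<close> unfolding alternating_def by (fastforce simp: image_iff)
qed

lemma class_subset: "(if c then P1 z else P2 z) \<subseteq> set z"
  by (auto simp: P1_def P2_def set_conv_nth)

section \<open>Cycles listed from their heaviest element\<close>

context
  fixes p :: "'a \<Rightarrow> 'a" and X :: "'a set" and w :: "'a \<Rightarrow> nat"
  assumes perm: "p permutes X" and fin: "finite X" and inj: "inj_on w X"
begin

lemma permutation_p: "permutation p"
  using perm fin by (auto simp: permutation_permutes)

lemma self_in_support: "x \<in> set (support p x)"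
  using least_power_of_permutation(2)[OF permutation_p, of x] by force

lemma set_support_eqI:
  assumes "y \<in> set (support p a)" and "y \<in> set (support p b)"
  shows "set (support p a) = set (support p b)"
proof (rule ccontr)
  assume "set (support p a) \<noteq> set (support p b)"
  from disjointD[OF disjoint_support[OF permutation_p] rangeI rangeI this] show False
    using assms by blast
qed

lemma funpow_in: "x \<in> X \<Longrightarrow> (p ^^ k) x \<in> X"
  by (induction k) (use perm in \<open>auto simp: permutes_in_image\<close>)

lemma leader_cycle_subset: "z \<in> leader_cycles w p X \<Longrightarrow> set z \<subseteq> X"
  using funpow_in by (auto simp: leader_cycles_def)

lemma finite_leader_cycles: "finite (leader_cycles w p X)"
  by (rule finite_subset[of _ "(\<lambda>x. support p x) ` X"]) (use fin in \<open>auto simp: leader_cycles_def\<close>)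

lemma leader_cycle_closed:
  assumes "z \<in> leader_cycles w p X" and "x \<in> set z"
  shows "p x \<in> set z"
proof -
  obtain e where z: "z = support p e"
    using assms(1) by (auto simp: leader_cycles_def)
  obtain k where "x = (p ^^ k) e"
    using assms(2) unfolding z support_set[OF permutation_p] by blast
  then have "p x = (p ^^ Suc k) e" by simp
  then show ?thesis
    unfolding z support_set[OF permutation_p] by blast
qed

text \<open>Orbits that meet coincide, and each list starts at the heaviest element of its orbit.
  Injectivity of \<open>w\<close> then makes the starting points equal, and with them the
  lists.\<close>

lemma disjoint_leader_cycles:
  assumes "z \<in> leader_cycles w p X" and "z' \<in> leader_cycles w p X" and "z \<noteq> z'"
  shows "set z \<inter> set z' = {}"
proof (rule ccontr)
  assume meet: "set z \<inter> set z' \<noteq> {}"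
  obtain e where e: "e \<in> X" "z = support p e" "\<forall>y\<in>set z. w y \<le> w e"
    using assms(1) by (auto simp: leader_cycles_def)
  obtain e' where e': "e' \<in> X" "z' = support p e'" "\<forall>y\<in>set z'. w y \<le> w e'"
    using assms(2) by (auto simp: leader_cycles_def)
  have "set z = set z'"
    using meet set_support_eqI unfolding e(2) e'(2) by blast
  then have "w e' \<le> w e" "w e \<le> w e'"
    using e e' self_in_support by metis+
  then have "e = e'"
    using inj e(1) e'(1) by (auto simp: inj_on_def)
  then show False
    using e e' assms(3) by simp
qed

lemma Union_leader_cycles: "(\<Union>z\<in>leader_cycles w p X. set z) = X"
proof
  show "(\<Union>z\<in>leader_cycles w p X. set z) \<subseteq> X"
    using leader_cycle_subset by blast
  show "X \<subseteq> (\<Union>z\<in>leader_cycles w p X. set z)"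
  proof
    fix x assume x: "x \<in> X"
    let ?C = "set (support p x)"
    have "finite (w ` ?C)" "w ` ?C \<noteq> {}"
      using self_in_support[of x] by auto
    \<comment> \<open>The listed cycle through \<open>x\<close> need not start at \<open>x\<close>;
      it starts at the heaviest element \<open>e\<close> of the same orbit.\<close>
    from Max_in[OF this] obtain e where e: "e \<in> ?C" "w e = Max (w ` ?C)"
      by (metis imageE)
    have e_max: "\<forall>y\<in>?C. w y \<le> w e"
      unfolding e(2) by (auto intro!: Max_ge simp del: set_map)
    have "e \<in> X"
      using e(1) x funpow_in by auto
    have same: "set (support p e) = ?C"
      by (rule set_support_eqI[OF self_in_support e(1)])
    have "support p e \<in> leader_cycles w p X"
      using \<open>e \<in> X\<close> e_max same unfolding leader_cycles_def by blast
    then show "x \<in> (\<Union>z\<in>leader_cycles w p X. set z)"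
      using same self_in_support[of x] by blast
  qed
qed

section \<open>Alternating sets as choices of one class per cycle\<close>

lemma alternating_funpow:
  assumes "alternating p X E" and "x \<in> X"
  shows "(p ^^ k) x \<in> E \<longleftrightarrow> (x \<in> E \<longleftrightarrow> even k)"
proof (induction k)
  case (Suc k)
  then show ?case
    using assms(1) funpow_in[OF assms(2), of k] by (auto simp: alternating_def)
qed simp

text \<open>Entry \<open>k\<close> of \<open>z\<close> is the image of the first entry under
  \<open>p ^^ k\<close>, so its membership in \<open>E\<close> depends only on the parity of
  \<open>k\<close>. The two cases are those of the first entry lying inside or outside
  \<open>E\<close>.\<close>

lemma alternating_classes:
  assumes "alternating p X E" and "z \<in> leader_cycles w p X"
  shows "P1 z = set z \<inter> E \<and> P2 z = set z - E \<or> P1 z = set z - E \<and> P2 z = set z \<inter> E"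
proof -
  obtain e where e: "e \<in> X" "z = support p e"
    using assms(2) by (auto simp: leader_cycles_def)
  have nth: "z ! k \<in> E \<longleftrightarrow> (e \<in> E \<longleftrightarrow> even k)" if "k < length z" for k
    using alternating_funpow[OF assms(1) e(1)] that unfolding e(2) by simp
  have "P1 z = {x \<in> set z. x \<in> E \<longleftrightarrow> e \<in> E}" "P2 z = {x \<in> set z. x \<in> E \<longleftrightarrow> e \<notin> E}"
    using nth unfolding P1_def P2_def set_conv_nth by auto
  then show ?thesis by auto
qed

lemma choose_classes_inter:
  assumes "z \<in> leader_cycles w p X"
  shows "choose_classes (leader_cycles w p X) S \<inter> set z = (if z \<in> S then P1 z else P2 z)"
proof -
  have "(if z' \<in> S then P1 z' else P2 z') \<inter> set z = {}"
    if "z' \<in> leader_cycles w p X" "z' \<noteq> z" for z'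
    using disjoint_leader_cycles[OF that(1) assms that(2)] class_subset[of _ z'] by blast
  moreover have "(if z \<in> S then P1 z else P2 z) \<subseteq> set z"
    by (rule class_subset)
  ultimately show ?thesis
    using assms unfolding choose_classes_def by blast
qed

text \<open>The given \<open>E\<close> guarantees that \<open>p\<close> interchanges
  \<open>P1 z\<close> and \<open>P2 z\<close> on every cycle, which would fail on a cycle of odd
  length.\<close>

lemma alternating_choose_classes:
  assumes "alternating p X E"
  shows "alternating p X (choose_classes (leader_cycles w p X) S)"
  unfolding alternating_def
proof (intro conjI ballI)
  let ?F = "choose_classes (leader_cycles w p X) S"
  show "?F \<subseteq> X"
    unfolding choose_classes_def
    by (intro UN_least subset_trans[OF class_subset leader_cycle_subset])
  fix x assume "x \<in> X"
  then obtain z where z: "z \<in> leader_cycles w p X" "x \<in> set z"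
    using Union_leader_cycles by blast
  have px: "p x \<in> set z"
    using z by (rule leader_cycle_closed)
  have flip: "p x \<in> E \<longleftrightarrow> x \<notin> E"
    using assms \<open>x \<in> X\<close> by (simp add: alternating_def)
  \<comment> \<open>On a single cycle the choice agrees with \<open>E\<close> or with its
    complement, and \<open>p\<close> flips membership in both.\<close>
  have "?F \<inter> set z = set z \<inter> E \<or> ?F \<inter> set z = set z - E"
    using choose_classes_inter[OF z(1)] alternating_classes[OF assms z(1)] by auto
  then show "p x \<in> ?F \<longleftrightarrow> x \<notin> ?F"
    using px z(2) flip by blast
qed

lemma alternating_eq_choose_classes:
  assumes "alternating p X E"
  shows "\<exists>S\<subseteq>leader_cycles w p X. E = choose_classes (leader_cycles w p X) S"
proof (intro exI conjI)
  let ?Z = "leader_cycles w p X"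
  \<comment> \<open>\<open>P1\<close> is taken from the cycles on which it is the part inside
    \<open>E\<close>; on every other cycle that part is \<open>P2\<close>.\<close>
  let ?S = "{z \<in> ?Z. P1 z = set z \<inter> E}"
  show "?S \<subseteq> ?Z" by blast
  have "(if z \<in> ?S then P1 z else P2 z) = set z \<inter> E" if "z \<in> ?Z" for z
    using alternating_classes[OF assms that] that by auto
  then have "choose_classes ?Z ?S = (\<Union>z\<in>?Z. set z \<inter> E)"
    unfolding choose_classes_def by (intro SUP_cong) auto
  also have "\<dots> = E"
    using Union_leader_cycles assms by (simp add: alternating_def Int_absorb1 flip: UN_extend_simps(4))
  finally show "E = choose_classes ?Z ?S" ..
qed

text \<open>Disjointness of the cycles splits the sum. With \<open>v\<close> the weight, the
  right-hand side is the exponent of the term indexed by \<open>S\<close> in the multiplied-out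
  product over the cycles.\<close>

lemma sum_choose_classes:
  fixes v :: "'a \<Rightarrow> nat"
  assumes "S \<subseteq> leader_cycles w p X"
  shows "sum v (choose_classes (leader_cycles w p X) S)
    = (\<Sum>z\<in>S. sum v (P1 z)) + (\<Sum>z\<in>leader_cycles w p X - S. sum v (P2 z))"
proof -
  let ?Z = "leader_cycles w p X"
  have sub: "(if z \<in> S then P1 z else P2 z) \<subseteq> set z" for z
    by (rule class_subset)
  have "sum v (choose_classes ?Z S) = (\<Sum>z\<in>?Z. sum v (if z \<in> S then P1 z else P2 z))"
    unfolding choose_classes_def
  proof (rule sum.UNION_disjoint)
    show "\<forall>z\<in>?Z. finite (if z \<in> S then P1 z else P2 z)"
      using sub finite_subset by blast
    show "\<forall>z\<in>?Z. \<forall>z'\<in>?Z. z \<noteq> z' \<longrightarrow>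
        (if z \<in> S then P1 z else P2 z) \<inter> (if z' \<in> S then P1 z' else P2 z') = {}"
      using sub disjoint_leader_cycles by blast
  qed (rule finite_leader_cycles)
  also have "\<dots> = (\<Sum>z\<in>?Z. if z \<in> S then sum v (P1 z) else sum v (P2 z))"
    by (intro sum.cong) auto
  also have "\<dots> = (\<Sum>z\<in>?Z \<inter> S. sum v (P1 z)) + (\<Sum>z\<in>?Z \<inter> - S. sum v (P2 z))"
    using sum.If_cases[OF finite_leader_cycles, of "\<lambda>z. z \<in> S"] by simp
  finally show ?thesis
    using assms by (simp add: Diff_eq Int_absorb1)
qed

end

section \<open>Exponents of polynomials with nonnegative coefficients\<close>

text \<open>A sum of nonnegative coefficients vanishes only if each of them does, so nothing
  cancels.\<close>

lemma exponents_sum_nonneg: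
  fixes f :: "'b \<Rightarrow> 'a::ordered_comm_monoid_add poly"
  assumes "finite A" and "\<And>a k. a \<in> A \<Longrightarrow> 0 \<le> coeff (f a) k"
  shows "exponents (\<Sum>a\<in>A. f a) = (\<Union>a\<in>A. exponents (f a))"
  using assms by (auto simp: exponents_def coeff_sum sum_nonneg_eq_0_iff)

lemma exponents_sum_monom:
  fixes m :: "'b \<Rightarrow> nat"
  assumes "finite A"
  shows "exponents (\<Sum>a\<in>A. monom (1 :: int) (m a)) = m ` A"
proof -
  have "exponents (\<Sum>a\<in>A. monom (1 :: int) (m a)) = (\<Union>a\<in>A. exponents (monom (1 :: int) (m a)))"
    using assms by (intro exponents_sum_nonneg) auto
  also have "\<dots> = m ` A"
    by (auto simp: exponents_def split: if_splits)
  finally show ?thesis .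
qed

lemma prod_monom_one:
  "(\<Prod>a\<in>A. monom (1 :: 'a::comm_semiring_1) (m a)) = monom 1 (\<Sum>a\<in>A. m a)"
  by (induction A rule: infinite_finite_induct) (simp_all add: mult_monom)

section \<open>The weights\<close>

lemma finite_all_edges: "finite V \<Longrightarrow> finite (all_edges V)"
  by (rule finite_subset[of _ "Pow V"]) (auto simp: all_edges_def)

text \<open>Row \<open>k\<close> consists of the \<open>n - k\<close> pairs with smaller element
  \<open>k\<close>; the formula counts the pairs in the rows before row \<open>i\<close>. Proving
  the doubled identity first shows that the division by 2 is exact.\<close>

lemma row_offset:
  fixes i n :: nat
  assumes "1 \<le> i" and "i \<le> n"
  shows "(2 * n - i) * (i - 1) div 2 = (\<Sum>k\<in>{1..<i}. n - k)"
proof -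
  from assms have "(2 * n - i) * (i - 1) = 2 * (\<Sum>k\<in>{1..<i}. n - k)"
  proof (induction i rule: nat_induct_at_least)
    case (Suc i)
    then have "2 * (\<Sum>k\<in>{1..<Suc i}. n - k) = (2 * n - i) * (i - 1) + 2 * (n - i)"
      by simp
    also have "\<dots> = (2 * n - Suc i) * (Suc i - 1)"
    proof -
      \<comment> \<open>These substitutions remove the truncated subtractions, leaving an identity
        for \<open>algebra_simps\<close>.\<close>
      obtain a where a: "i = Suc a" using Suc by (cases i) auto
      obtain b where "n = Suc i + b" using Suc le_Suc_ex by blast
      then show ?thesis by (simp add: a algebra_simps)
    qed
    finally show ?case ..
  qed simp
  then show ?thesis by simp
qed

lemma edge_pos_insert:
  assumes "1 \<le> i" and "i < j" and "j \<le> n"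
  shows "edge_pos n {i, j} = (\<Sum>k\<in>{1..<i}. n - k) + (j - i)"
  using assms row_offset[of i n] by (simp add: edge_pos_def Let_def)

text \<open>Since \<open>j - i \<le> n - i\<close>, the position is at most the end of row
  \<open>i\<close>, and the rows before \<open>i'\<close> include row \<open>i\<close>.\<close>

lemma edge_pos_le_row_end:
  assumes "1 \<le> i" and "i < j" and "j \<le> n" and "i < i'"
  shows "edge_pos n {i, j} \<le> (\<Sum>k\<in>{1..<i'}. n - k)"
proof -
  have "edge_pos n {i, j} \<le> (\<Sum>k\<in>{1..<Suc i}. n - k)"
    using assms by (simp add: edge_pos_insert)
  also have "\<dots> \<le> (\<Sum>k\<in>{1..<i'}. n - k)"
    using assms by (intro sum_mono2) auto
  finally show ?thesis .
qed

lemma all_edges_verticesE: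
  assumes "e \<in> all_edges (vertices n)"
  obtains i j where "e = {i, j}" "1 \<le> i" "i < j" "j \<le> n"
proof -
  obtain a b where "e = {a, b}" "a \<noteq> b"
    using assms by (auto simp: all_edges_def card_2_iff)
  then show thesis
    using assms that[of a b] that[of b a]
    by (cases "a < b") (auto simp: all_edges_def vertices_def insert_commute)
qed

text \<open>Rows occupy disjoint stretches of positions: a pair in a later row lies strictly beyond
  the end of the earlier one, its offset in the row being positive. The position thus fixes the row,
  and then the larger element.\<close>

lemma inj_on_edge_pos: "inj_on (edge_pos n) (all_edges (vertices n))"
proof (rule inj_onI)
  fix e e' assume "e \<in> all_edges (vertices n)" "e' \<in> all_edges (vertices n)"
    and eq: "edge_pos n e = edge_pos n e'"
  then obtain i j i' j' where e: "e = {i, j}" "1 \<le> i" "i < j" "j \<le> n"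
    and e': "e' = {i', j'}" "1 \<le> i'" "i' < j'" "j' \<le> n"
    by (elim all_edges_verticesE) blast
  have "i = i'"
  proof (rule linorder_cases[of i i'])
    assume "i < i'"
    then show ?thesis
      using edge_pos_le_row_end[OF e(2-4), of i'] edge_pos_insert[OF e'(2-4)] eq e e' by simp
  next
    assume "i' < i"
    then show ?thesis
      using edge_pos_le_row_end[OF e'(2-4), of i] edge_pos_insert[OF e(2-4)] eq e e' by simp
  qed
  moreover from this have "j = j'"
    using edge_pos_insert[OF e(2-4)] edge_pos_insert[OF e'(2-4)] eq e e' by simp
  ultimately show "e = e'"
    using e(1) e'(1) by simp
qed

lemma edge_pos_le_choose:
  assumes "e \<in> all_edges (vertices n)"
  shows "edge_pos n e \<le> n choose 2"
proof -
  obtain i j where e: "e = {i, j}" "1 \<le> i" "i < j" "j \<le> n"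
    using assms by (rule all_edges_verticesE)
  \<comment> \<open>Here \<open>i < n\<close>, so the row bound may be taken at \<open>n\<close>,
    where the sum runs over all nonempty rows.\<close>
  have "edge_pos n e \<le> (\<Sum>k\<in>{1..<n}. n - k)"
    using edge_pos_le_row_end[OF e(2-4), of n] e by simp
  also have "\<dots> = (2 * n - n) * (n - 1) div 2"
    using e by (intro row_offset[symmetric]) auto
  also have "\<dots> = n choose 2"
    by (simp add: choose_two)
  finally show ?thesis .
qed

text \<open>The bound \<open>edge_pos_le_choose\<close> excludes truncation, so injectivity passes
  from positions to exponents.\<close>

lemma inj_on_weight_exponent:
  "inj_on (\<lambda>e. (n choose 2) - edge_pos n e) (all_edges (vertices n))"
proof (rule inj_onI)
  fix e f assume ef: "e \<in> all_edges (vertices n)" "f \<in> all_edges (vertices n)"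
    and "(n choose 2) - edge_pos n e = (n choose 2) - edge_pos n f"
  then have "edge_pos n e = edge_pos n f"
    using edge_pos_le_choose[OF ef(1)] edge_pos_le_choose[OF ef(2)] by linarith
  then show "e = f"
    using inj_on_edge_pos ef by (simp add: inj_on_def)
qed

lemma inj_on_weight: "inj_on (weight n) (all_edges (vertices n))"
  using inj_on_weight_exponent by (auto simp: inj_on_def weight_def)

lemma inj_on_sum_weight: "inj_on (sum (weight n)) (Pow (all_edges (vertices n)))"
proof (rule inj_onI)
  let ?X = "all_edges (vertices n)" and ?q = "\<lambda>e. (n choose 2) - edge_pos n e"
  fix E F assume EF: "E \<in> Pow ?X" "F \<in> Pow ?X" and eq: "sum (weight n) E = sum (weight n) F"
  have fin: "finite ?X"
    by (simp add: finite_all_edges vertices_def)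
  \<comment> \<open>\<open>set_encode\<close> sums \<open>2 ^ k\<close> over a finite set of
    exponents; its injectivity is the uniqueness of binary expansions.\<close>
  have encode: "sum (weight n) D = set_encode (?q ` D)" if "D \<subseteq> ?X" for D
    using inj_on_subset[OF inj_on_weight_exponent that]
    by (simp add: set_encode_def sum.reindex weight_def)
  have "?q ` E = ?q ` F"
    using EF eq encode fin by (metis PowD finite_imageI finite_subset set_encode_eq)
  then show "E = F"
    using EF inj_on_image_eq_iff[OF inj_on_weight_exponent] by blast
qed

section \<open>Exponents of the generating polynomial\<close>

lemma permutes_edge_perm:
  assumes "\<alpha> permutes vertices n"
  shows "edge_perm n \<alpha> permutes all_edges (vertices n)"
proof (rule bij_imp_permutes)
  let ?X = "all_edges (vertices n)"
  have inj: "inj \<alpha>" and "\<alpha> ` vertices n = vertices n"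
    using assms by (simp_all add: permutes_inj permutes_image)
  have fin: "finite ?X"
    by (simp add: finite_all_edges vertices_def)
  have "inj_on (edge_perm n \<alpha>) ?X"
    using inj by (auto simp: inj_on_def edge_perm_def inj_image_eq_iff)
  moreover have "edge_perm n \<alpha> ` ?X \<subseteq> ?X"
  proof -
    have "card (\<alpha> ` e) = card e" for e
      using inj by (meson card_image inj_on_subset subset_UNIV)
    then show ?thesis
      using \<open>\<alpha> ` vertices n = vertices n\<close> by (auto simp: edge_perm_def all_edges_def)
  qed
  ultimately show "bij_betw (edge_perm n \<alpha>) ?X ?X"
    using fin by (simp add: bij_betw_def endo_inj_surj)
qed (simp add: edge_perm_def)

section \<open>Self-complementary graphs as alternating edge sets\<close>

lemma relabel_eq_complement_iff:
  assumes "\<alpha> permutes vertices n" and "E \<subseteq> all_edges (vertices n)"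
  shows "relabel \<alpha> (vertices n, E) = graph_complement (vertices n, E)
    \<longleftrightarrow> alternating (edge_perm n \<alpha>) (all_edges (vertices n)) E"
proof -
  have "(\<lambda>e. \<alpha> ` e) ` E = edge_perm n \<alpha> ` E"
    using assms(2) by (intro image_cong) (auto simp: edge_perm_def)
  then show ?thesis
    using image_eq_Diff_iff_alternating[OF permutes_edge_perm[OF assms(1)] assms(2)]
    by (simp add: relabel_def graph_complement_def)
qed

lemma edge_cycles_eq_leader_cycles:
  "edge_cycles n \<alpha> = leader_cycles (weight n) (edge_perm n \<alpha>) (all_edges (vertices n))"
  by (simp add: edge_cycles_def leader_cycles_def)

lemma mem_sc_graphs_iff:
  "G \<in> sc_graphs n \<longleftrightarrow> (\<exists>\<alpha> E. \<alpha> permutes vertices n \<and> G = (vertices n, E)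
     \<and> alternating (edge_perm n \<alpha>) (all_edges (vertices n)) E)"
proof -
  have "(vertices n, E) \<in> sc_graphs n \<longleftrightarrow> (\<exists>\<alpha>. \<alpha> permutes vertices n
      \<and> alternating (edge_perm n \<alpha>) (all_edges (vertices n)) E)" for E
  proof (cases "E \<subseteq> all_edges (vertices n)")
    case True
    then show ?thesis
      using relabel_eq_complement_iff[OF _ True]
      by (auto simp: sc_graphs_def labelled_graphs_def self_complementary_def)
  next
    \<comment> \<open>Both sides fail, as each requires every edge to be a 2-subset of the
      vertices.\<close>
    case False
    then show ?thesis
      by (auto simp: sc_graphs_def labelled_graphs_def alternating_def)
  qed
  moreover have "fst G = vertices n" if "G \<in> sc_graphs n"
    using that by (auto simp: sc_graphs_def labelled_graphs_def)
  ultimately show ?thesis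
    by (metis prod.collapse)
qed

lemma mem_sc_perms_iff:
  "\<alpha> \<in> sc_perms n \<longleftrightarrow> \<alpha> permutes vertices n
     \<and> (\<exists>E. alternating (edge_perm n \<alpha>) (all_edges (vertices n)) E)"
proof -
  have "(\<exists>G\<in>sc_graphs n. relabel \<alpha> G = graph_complement G)
      \<longleftrightarrow> (\<exists>E. alternating (edge_perm n \<alpha>) (all_edges (vertices n)) E)" (is "?L \<longleftrightarrow> ?R")
    if perm: "\<alpha> permutes vertices n"
  proof
    assume ?L
    then obtain E where "relabel \<alpha> (vertices n, E) = graph_complement (vertices n, E)"
      "E \<subseteq> all_edges (vertices n)"
      by (auto simp: mem_sc_graphs_iff alternating_def)
    then show ?R
      using relabel_eq_complement_iff[OF perm] by blast
  next
    assume ?R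
    then obtain E where E: "alternating (edge_perm n \<alpha>) (all_edges (vertices n)) E" ..
    then have "(vertices n, E) \<in> sc_graphs n"
      using perm mem_sc_graphs_iff by blast
    moreover have "relabel \<alpha> (vertices n, E) = graph_complement (vertices n, E)"
      using E relabel_eq_complement_iff[OF perm] by (simp add: alternating_def)
    ultimately show ?L by blast
  qed
  then show ?thesis
    unfolding sc_perms_def by blast
qed

section \<open>Expansion of the polynomial of a single permutation\<close>

context
  fixes n :: nat and \<alpha> :: "nat \<Rightarrow> nat"
  assumes perm: "\<alpha> permutes vertices n"
begin

lemma edge_perm_setup:
  "edge_perm n \<alpha> permutes all_edges (vertices n)" "finite (all_edges (vertices n))"
  "inj_on (weight n) (all_edges (vertices n))"
  using permutes_edge_perm[OF perm] inj_on_weight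
  by (simp_all add: finite_all_edges vertices_def)

lemma U_perm_expand:
  "U_perm n \<alpha> = (\<Sum>S\<in>Pow (edge_cycles n \<alpha>).
     monom 1 (sum (weight n) (choose_classes (edge_cycles n \<alpha>) S)))"
proof -
  have fin: "finite (edge_cycles n \<alpha>)"
    unfolding edge_cycles_eq_leader_cycles by (rule finite_leader_cycles[OF edge_perm_setup])
  have "U_perm n \<alpha> = (\<Sum>S\<in>Pow (edge_cycles n \<alpha>).
      monom 1 ((\<Sum>z\<in>S. W1 n z) + (\<Sum>z\<in>edge_cycles n \<alpha> - S. W2 n z)))"
    \<comment> \<open>\<open>prod_add\<close> multiplies out the product; \<open>S\<close> is the
      set of cycles whose \<open>W1\<close> monomial is taken.\<close>
    unfolding U_perm_def by (simp add: prod_add[OF fin] prod_monom_one mult_monom)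
  also have "\<dots> = (\<Sum>S\<in>Pow (edge_cycles n \<alpha>).
      monom 1 (sum (weight n) (choose_classes (edge_cycles n \<alpha>) S)))"
    unfolding W1_def W2_def edge_cycles_eq_leader_cycles
    by (intro sum.cong refl) (simp add: sum_choose_classes[OF edge_perm_setup])
  finally show ?thesis .
qed

lemma coeff_U_perm_nonneg: "0 \<le> coeff (U_perm n \<alpha>) k"
  unfolding U_perm_expand coeff_sum by (rule sum_nonneg) simp

text \<open>The expansion holds for every vertex permutation, but its exponents come from
  alternating sets only if one exists: an odd cycle would leave exponents without any alternating
  set.\<close>

lemma exponents_U_perm:
  assumes "\<exists>E. alternating (edge_perm n \<alpha>) (all_edges (vertices n)) E"
  shows "exponents (U_perm n \<alpha>)
    = sum (weight n) ` {E. alternating (edge_perm n \<alpha>) (all_edges (vertices n)) E}"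
proof -
  let ?Z = "edge_cycles n \<alpha>"
  have "finite ?Z"
    unfolding edge_cycles_eq_leader_cycles by (rule finite_leader_cycles[OF edge_perm_setup])
  then have "exponents (U_perm n \<alpha>) = sum (weight n) ` choose_classes ?Z ` Pow ?Z"
    unfolding U_perm_expand by (simp add: exponents_sum_monom image_image)
  moreover have "choose_classes ?Z ` Pow ?Z
      = {E. alternating (edge_perm n \<alpha>) (all_edges (vertices n)) E}"
    using assms alternating_choose_classes[OF edge_perm_setup]
      alternating_eq_choose_classes[OF edge_perm_setup]
    unfolding edge_cycles_eq_leader_cycles by blast
  ultimately show ?thesis by simp
qed

end

lemma finite_sc_perms: "finite (sc_perms n)"
  by (rule finite_subset[OF _ finite_permutations[of "vertices n"]])
    (auto simp: sc_perms_def vertices_def)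

lemma exponents_U: "exponents (U n) = (\<lambda>G. sum (weight n) (snd G)) ` sc_graphs n"
proof -
  let ?alt = "\<lambda>\<alpha> E. alternating (edge_perm n \<alpha>) (all_edges (vertices n)) E"
  have "exponents (U n) = (\<Union>\<alpha>\<in>sc_perms n. exponents (U_perm n \<alpha>))"
    unfolding U_def using finite_sc_perms coeff_U_perm_nonneg
    by (intro exponents_sum_nonneg) (auto simp: mem_sc_perms_iff)
  also have "\<dots> = (\<Union>\<alpha>\<in>sc_perms n. sum (weight n) ` {E. ?alt \<alpha> E})"
    by (intro SUP_cong refl exponents_U_perm) (auto simp: mem_sc_perms_iff)
  \<comment> \<open>An alternating set of any induced permutation gives a self-complementary graph;
    conversely, the permutation witnessing such a graph lies in \<open>sc_perms n\<close>.\<close>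
  also have "\<dots> = (\<lambda>G. sum (weight n) (snd G)) ` sc_graphs n"
    by (force simp: mem_sc_perms_iff mem_sc_graphs_iff image_iff)
  finally show ?thesis .
qed

theorem theorem9:
  fixes n :: nat
  assumes "n \<ge> 4" and "n mod 4 = 0 \<or> n mod 4 = 1"
  shows "lsc n = card (exponents (U n))"
proof -
  \<comment> \<open>All these graphs share one vertex set, so the total weight of the edges
    determines the graph.\<close>
  have "inj_on (\<lambda>G. sum (weight n) (snd G)) (sc_graphs n)"
  proof (rule inj_onI)
    fix G H assume "G \<in> sc_graphs n" "H \<in> sc_graphs n"
      and "sum (weight n) (snd G) = sum (weight n) (snd H)"
    then show "G = H"
      using inj_onD[OF inj_on_sum_weight, of n "snd G" "snd H"]
      by (auto simp: sc_graphs_def labelled_graphs_def)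
  qed
  then show ?thesis
    by (simp add: lsc_def exponents_U card_image)
qed

end
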